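(* Let $h\in\mathbb{N}$ and let $w \in \mathcal{W}_h$. If $\operatorname{rank}(w) \leq \frac{h}{2}$, then the functional equivalence class $\mathfrak{F}[w]$ has diameter at most $7$.
   Context: For $h \in \mathbb{N}$ let $\mathcal{W}_h = \mathbb{R}^{3h+1}$, with elements (parameters) written $w = (a_1,b_1,c_1,\ldots,a_h,b_h,c_h,d)$, where $a_i,b_i,c_i,d\in\mathbb{R}$. Each $w\in\mathcal{W}_h$ defines $f_w:\mathbb{R}\to\mathbb{R}$ by $f_w(x) = d + \sum_{i=1}^h a_i\tanh(b_i x + c_i)$. The functional equivalence class of $w\in\mathcal{W}_h$ is $\mathfrak{F}[w]=\{w'\in\mathcal{W}_h \mid f_w=f_{w'}\}$. The rank of $w\in\mathcal{W}_h$ is $\operatorname{rank}(w)=\min\{h'\in\mathbb{N} \mid \exists w'\in\mathcal{W}_{h'},\ f_w=f_{w'}\}$. For $W\subseteq\mathcal{W}_h$, a piecewise linear path in $W$ is a continuous function $\rho:[0,1]\to W$ comprising a finite number of linear (affine) segments; it connects $\rho(0)$ to $\rho(1)$. The length of a piecewise linear path is the number of maximal linear segments comprising the path. The distance (in $W$) between two parameters connected by a piecewise linear path in $W$ is the length of the shortest such path. The diameter of a piecewise linear path-connected set $W$ (one in which any two parameters are connected by a piecewise linear path in $W$) is the largest distance in $W$ between any two parameters in $W$. Thus "$W$ has diameter at most $7$" means that any two parameters in $W$ are connected by a piecewise linear path in $W$ with at most $7$ linear segments. *)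

theory Defs
  imports "HOL-Analysis.Analysis"
begin

text \<open>
  The space of parameters with \<open>h\<close> hidden units is the (3h+1)-dimensional Euclidean space of
  sequences vanishing from index 3h+1 on. Units are numbered from 0, so that
  \<open>w = (a\<^sub>0, b\<^sub>0, c\<^sub>0, \<dots>, a\<^sub>h\<^sub>-\<^sub>1, b\<^sub>h\<^sub>-\<^sub>1, c\<^sub>h\<^sub>-\<^sub>1, d)\<close> has \<open>a\<^sub>i = w (3i)\<close>, \<open>b\<^sub>i = w (3i+1)\<close>,
  \<open>c\<^sub>i = w (3i+2)\<close> and \<open>d = w (3h)\<close>.
\<close>

definition params :: "nat \<Rightarrow> (nat \<Rightarrow> real) set" where
  "params h = topspace (Euclidean_space (3 * h + 1))"

definition net :: "nat \<Rightarrow> (nat \<Rightarrow> real) \<Rightarrow> real \<Rightarrow> real" where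
  "net h w x = w (3 * h) + (\<Sum>i<h. w (3 * i) * tanh (w (3 * i + 1) * x + w (3 * i + 2)))"

definition functional_class :: "nat \<Rightarrow> (nat \<Rightarrow> real) \<Rightarrow> (nat \<Rightarrow> real) set" where
  "functional_class h w = {w' \<in> params h. net h w = net h w'}"

definition net_rank :: "nat \<Rightarrow> (nat \<Rightarrow> real) \<Rightarrow> nat" where
  "net_rank h w = (LEAST h'. \<exists>w'\<in>params h'. net h w = net h' w')"

definition affine_segment :: "(real \<Rightarrow> nat \<Rightarrow> real) \<Rightarrow> real \<Rightarrow> real \<Rightarrow> bool" where
  "affine_segment \<rho> s t \<longleftrightarrow> (\<exists>p q. \<forall>x\<in>{s..t}. \<rho> x = (\<lambda>j. p j + x * q j))"

definition pl_path :: "nat \<Rightarrow> (nat \<Rightarrow> real) set \<Rightarrow> (real \<Rightarrow> nat \<Rightarrow> real) \<Rightarrow> bool" where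
  "pl_path n W \<rho> \<longleftrightarrow>
     pathin (subtopology (Euclidean_space n) W) \<rho> \<and>
     (\<exists>k (\<tau> :: nat \<Rightarrow> real). \<tau> 0 = 0 \<and> \<tau> k = 1 \<and>
        (\<forall>i<k. \<tau> i < \<tau> (Suc i) \<and> affine_segment \<rho> (\<tau> i) (\<tau> (Suc i))))"

text \<open>Nondegenerate subintervals \<open>[s, t]\<close> of \<open>[0, 1]\<close>, encoded as pairs, that are maximal
  (under inclusion) among those on which the path is affine.\<close>

definition maximal_segments :: "(real \<Rightarrow> nat \<Rightarrow> real) \<Rightarrow> (real \<times> real) set" where
  "maximal_segments \<rho> = {(s, t). 0 \<le> s \<and> s < t \<and> t \<le> 1 \<and> affine_segment \<rho> s t \<and>
     (\<forall>s' t'. 0 \<le> s' \<and> s' \<le> s \<and> t \<le> t' \<and> t' \<le> 1 \<and> affine_segment \<rho> s' t' \<longrightarrow> s' = s \<and> t' = t)}"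

definition pl_length :: "(real \<Rightarrow> nat \<Rightarrow> real) \<Rightarrow> nat" where
  "pl_length \<rho> = card (maximal_segments \<rho>)"

text \<open>The distance is \<open>\<infinity>\<close> if no path exists, so a bounded diameter includes
  piecewise linear path-connectedness (see \<open>pl_diameter_le_iff\<close>).\<close>

definition pl_dist :: "nat \<Rightarrow> (nat \<Rightarrow> real) set \<Rightarrow> (nat \<Rightarrow> real) \<Rightarrow> (nat \<Rightarrow> real) \<Rightarrow> enat" where
  "pl_dist n W u v = (INF \<rho>\<in>{\<rho>. pl_path n W \<rho> \<and> \<rho> 0 = u \<and> \<rho> 1 = v}. enat (pl_length \<rho>))"

definition pl_diameter :: "nat \<Rightarrow> (nat \<Rightarrow> real) set \<Rightarrow> enat" where
  "pl_diameter n W = (SUP u\<in>W. SUP v\<in>W. pl_dist n W u v)"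

lemma pl_dist_le_iff:
  "pl_dist n W u v \<le> enat k \<longleftrightarrow>
     (\<exists>\<rho>. pl_path n W \<rho> \<and> \<rho> 0 = u \<and> \<rho> 1 = v \<and> pl_length \<rho> \<le> k)"
proof
  assume "pl_dist n W u v \<le> enat k"
  then have "pl_dist n W u v < enat (Suc k)"
    by (meson enat_ord_simps(2) lessI order_le_less_trans)
  then show "\<exists>\<rho>. pl_path n W \<rho> \<and> \<rho> 0 = u \<and> \<rho> 1 = v \<and> pl_length \<rho> \<le> k"
    unfolding pl_dist_def INF_less_iff by auto
next
  assume "\<exists>\<rho>. pl_path n W \<rho> \<and> \<rho> 0 = u \<and> \<rho> 1 = v \<and> pl_length \<rho> \<le> k"
  then show "pl_dist n W u v \<le> enat k"
    unfolding pl_dist_def by (auto intro: INF_lower2)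
qed

lemma pl_diameter_le_iff:
  "pl_diameter n W \<le> enat k \<longleftrightarrow>
     (\<forall>u\<in>W. \<forall>v\<in>W. \<exists>\<rho>. pl_path n W \<rho> \<and> \<rho> 0 = u \<and> \<rho> 1 = v \<and> pl_length \<rho> \<le> k)"
  unfolding pl_diameter_def SUP_le_iff pl_dist_le_iff ..

lemma affine_segment_union:
  assumes "affine_segment \<rho> s t" "affine_segment \<rho> s' t'" "max s s' < min t t'"
  shows "affine_segment \<rho> (min s s') (max t t')"
proof -
  obtain p q where pq: "\<And>x. x \<in> {s..t} \<Longrightarrow> \<rho> x = (\<lambda>j. p j + x * q j)"
    using assms(1) unfolding affine_segment_def by blast
  obtain p' q' where pq': "\<And>x. x \<in> {s'..t'} \<Longrightarrow> \<rho> x = (\<lambda>j. p' j + x * q' j)"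
    using assms(2) unfolding affine_segment_def by blast
  let ?x = "max s s'" and ?y = "min t t'"
  have eq: "p j = p' j \<and> q j = q' j" for j
  proof -
    have "p j + ?x * q j = p' j + ?x * q' j"
      using fun_cong[OF pq[of ?x], of j] fun_cong[OF pq'[of ?x], of j] assms(3) by simp
    moreover have "p j + ?y * q j = p' j + ?y * q' j"
      using fun_cong[OF pq[of ?y], of j] fun_cong[OF pq'[of ?y], of j] assms(3) by simp
    ultimately have "(?y - ?x) * (q j - q' j) = 0" by (simp add: algebra_simps)
    then have "q j = q' j" using assms(3) by simp
    with \<open>p j + ?x * q j = p' j + ?x * q' j\<close> show ?thesis by simp
  qed
  have "\<rho> x = (\<lambda>j. p j + x * q j)" if "x \<in> {min s s'..max t t'}" for x
  proof (cases "x \<in> {s..t}")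
    case True
    then show ?thesis by (rule pq)
  next
    case False
    then have "x \<in> {s'..t'}" using that assms(3) by (auto simp: min_def max_def split: if_splits)
    then show ?thesis using pq' eq by simp
  qed
  then show ?thesis unfolding affine_segment_def by blast
qed

lemma maximal_segments_absorb:
  assumes "(s, t) \<in> maximal_segments \<rho>" "affine_segment \<rho> s' t'" "0 \<le> s'" "t' \<le> 1"
    "max s s' < min t t'"
  shows "s \<le> s' \<and> t' \<le> t"
proof -
  have "affine_segment \<rho> (min s s') (max t t')"
    using assms affine_segment_union unfolding maximal_segments_def by blast
  moreover have "0 \<le> min s s'" "min s s' \<le> s" "t \<le> max t t'" "max t t' \<le> 1"
    using assms unfolding maximal_segments_def by auto
  ultimately have "min s s' = s \<and> max t t' = t"
    using assms(1) unfolding maximal_segments_def by blast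
  then show ?thesis by linarith
qed

text \<open>A path with an affine partition into \<open>k\<close> pieces has finitely many, and at most \<open>k\<close>,
  maximal segments; in particular the cardinality in \<open>pl_length\<close> is that of a finite set.\<close>

lemma maximal_segments_le:
  fixes \<tau> :: "nat \<Rightarrow> real"
  assumes "\<tau> 0 = 0" "\<tau> k = 1"
    and \<tau>: "\<And>i. i < k \<Longrightarrow> \<tau> i < \<tau> (Suc i) \<and> affine_segment \<rho> (\<tau> i) (\<tau> (Suc i))"
  shows "finite (maximal_segments \<rho>)" "card (maximal_segments \<rho>) \<le> k"
proof -
  have mono: "\<tau> i \<le> \<tau> j" if "i \<le> j" "j \<le> k" for i j
    using that by (induction j rule: dec_induct) (use \<tau> in \<open>force simp: Suc_le_eq\<close>)+
  have ex: "\<exists>i<k. max (fst m) (\<tau> i) < min (snd m) (\<tau> (Suc i))"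
    if mem: "m \<in> maximal_segments \<rho>" for m
  proof -
    obtain s t where m: "m = (s, t)" "0 \<le> s" "s < t" "t \<le> 1"
      using mem unfolding maximal_segments_def by blast
    define l where "l = (LEAST i. s < \<tau> i)"
    have "s < \<tau> k" using m assms by simp
    then have l: "s < \<tau> l" "l \<le> k" "\<And>i. i < l \<Longrightarrow> \<not> s < \<tau> i"
      unfolding l_def by (auto intro: LeastI Least_le dest: not_less_Least)
    moreover have "l \<noteq> 0" using l(1) m assms by (intro notI) simp
    then obtain i where "l = Suc i" by (cases l) auto
    moreover from this have "\<tau> i \<le> s" using l(3)[of i] by simp
    ultimately show ?thesis using m l by (intro exI[of _ i]) auto
  qed
  then obtain g where g: "\<And>m. m \<in> maximal_segments \<rho> \<Longrightarrow>
      g m < k \<and> max (fst m) (\<tau> (g m)) < min (snd m) (\<tau> (Suc (g m)))"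
    by metis
  have contains: "s \<le> \<tau> (g (s, t)) \<and> \<tau> (Suc (g (s, t))) \<le> t"
    if "(s, t) \<in> maximal_segments \<rho>" for s t
  proof (rule maximal_segments_absorb[OF that])
    show "affine_segment \<rho> (\<tau> (g (s, t))) (\<tau> (Suc (g (s, t))))" using \<tau> g[OF that] by blast
    show "0 \<le> \<tau> (g (s, t))" using mono[of 0 "g (s, t)"] g[OF that] assms by simp
    show "\<tau> (Suc (g (s, t))) \<le> 1" using mono[of "Suc (g (s, t))" k] g[OF that] assms by simp
    show "max s (\<tau> (g (s, t))) < min t (\<tau> (Suc (g (s, t))))" using g[OF that] by simp
  qed
  have inj: "inj_on g (maximal_segments \<rho>)"
  proof (rule inj_onI, clarify)
    fix s t s' t'
    assume *: "(s, t) \<in> maximal_segments \<rho>" "(s', t') \<in> maximal_segments \<rho>" "g (s, t) = g (s', t')"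
    have "\<tau> (g (s, t)) < \<tau> (Suc (g (s, t)))" using \<tau> g[OF *(1)] by blast
    then have overlap: "max s s' < min t t'" "max s' s < min t' t"
      using contains[OF *(1)] contains[OF *(2)] *(3) by auto
    have "s \<le> s' \<and> t' \<le> t"
      by (rule maximal_segments_absorb[OF *(1)])
        (use *(2) overlap in \<open>auto simp: maximal_segments_def\<close>)
    moreover have "s' \<le> s \<and> t \<le> t'"
      by (rule maximal_segments_absorb[OF *(2)])
        (use *(1) overlap in \<open>auto simp: maximal_segments_def\<close>)
    ultimately show "s = s' \<and> t = t'" by auto
  qed
  have sub: "g ` maximal_segments \<rho> \<subseteq> {..<k}" using g by auto
  show "finite (maximal_segments \<rho>)"
    using inj sub by (meson finite_imageD finite_lessThan finite_subset)
  show "card (maximal_segments \<rho>) \<le> k"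
    using card_inj_on_le[OF inj sub] by simp
qed

end

theory Submission
  imports Defs "HOL-Complex_Analysis.Complex_Analysis"
begin

text \<open>
  The segment between two parameters of the same class stays in the class if each unit either
  keeps its \<open>(b, c)\<close> or is blank (\<open>a = 0\<close>) at both ends. Since the functions
  \<open>tanh (b x + c)\<close> with \<open>b > 0\<close> and the constant 1 are linearly independent, the outgoing
  weights of any parameter \<open>u\<close> of a class of rank \<open>r\<close> can be redistributed, in one such segment,
  so that only a set \<open>P\<close> of at most \<open>r\<close> units is not blank; let \<open>Q\<close> be such a set for \<open>v\<close>.
  As \<open>2 r \<le> h\<close>, the units in \<open>P \<inter> Q\<close> can be relocated outside \<open>P \<union> Q\<close>, which turns \<open>P\<close> into
  a set \<open>N\<close> disjoint from \<open>Q\<close>. From \<open>u\<close> to \<open>v\<close> there are then seven segments: reduce to \<open>P\<close>, move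
  the blank units in \<open>N\<close>, transfer the weights from \<open>P\<close> to \<open>N\<close>, move the units outside \<open>N\<close> to
  their place in \<open>v\<close>, transfer the weights from \<open>N\<close> to \<open>Q\<close>, move the units in \<open>N\<close> to their place
  in \<open>v\<close>, and undo the reduction of \<open>v\<close>.
\<close>

section \<open>Segments and polygonal paths inside a functional class\<close>

text \<open>With \<open>(b, c)\<close> fixed, the output of a unit is linear in \<open>a\<close>,
  and a unit blank at both ends stays blank. So along the line the net is an affine combination of
  two equal functions, for every real \<open>t\<close>.\<close>

lemma step_convex:
  assumes x: "x \<in> functional_class h w" and y: "y \<in> functional_class h w"
    and xy: "\<And>i. i < h \<Longrightarrow> x (3*i+1) = y (3*i+1) \<and> x (3*i+2) = y (3*i+2) \<or> x (3*i) = 0 \<and> y (3*i) = 0"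
  shows "(\<lambda>j. x j + t * (y j - x j)) \<in> functional_class h w" (is "?z \<in> _")
proof -
  have unit: "?z (3*i) * tanh (?z (3*i+1) * s + ?z (3*i+2)) =
      (1 - t) * (x (3*i) * tanh (x (3*i+1) * s + x (3*i+2))) +
      t * (y (3*i) * tanh (y (3*i+1) * s + y (3*i+2)))" if "i < h" for i s
    using xy[OF that] by (auto simp: algebra_simps)
  have "net h ?z s = net h w s" for s
  proof -
    have "(\<Sum>i<h. ?z (3*i) * tanh (?z (3*i+1) * s + ?z (3*i+2))) =
        (1 - t) * (\<Sum>i<h. x (3*i) * tanh (x (3*i+1) * s + x (3*i+2))) +
        t * (\<Sum>i<h. y (3*i) * tanh (y (3*i+1) * s + y (3*i+2)))"
      unfolding sum_distrib_left sum.distrib[symmetric] by (rule sum.cong[OF refl]) (simp only: unit lessThan_iff)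
    then have "net h ?z s = (1 - t) * net h x s + t * net h y s"
      unfolding net_def by (simp add: algebra_simps)
    also have "\<dots> = net h w s"
      using x y by (simp add: functional_class_def algebra_simps)
    finally show ?thesis .
  qed
  then show ?thesis
    using x y by (auto simp: functional_class_def params_def topspace_Euclidean_space)
qed

text \<open>The length is only bounded by \<open>m\<close>, since consecutive pieces may merge into
  one maximal affine segment.\<close>

lemma polygonal_path:
  fixes p :: "nat \<Rightarrow> nat \<Rightarrow> real"
  assumes m: "0 < m" and W: "W \<subseteq> topspace (Euclidean_space n)"
    and seg: "\<And>k t. k < m \<Longrightarrow> 0 \<le> t \<Longrightarrow> t \<le> 1 \<Longrightarrow> (\<lambda>j. p k j + t * (p (Suc k) j - p k j)) \<in> W"
  shows "\<exists>\<rho>. pl_path n W \<rho> \<and> \<rho> 0 = p 0 \<and> \<rho> 1 = p m \<and> pl_length \<rho> \<le> m"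
proof -
  \<comment> \<open>The \<open>i\<close>-th clamped factor runs from 0 to 1 on \<open>[i/m, (i+1)/m]\<close>, so continuity is immediate.\<close>
  define \<rho> where "\<rho> x j = p 0 j + (\<Sum>i<m. max 0 (min 1 (real m * x - real i)) * (p (Suc i) j - p i j))"
    for x :: real and j
  define \<tau> where "\<tau> k = real k / real m" for k
  have \<rho>_eq: "\<rho> x j = p k j + (real m * x - real k) * (p (Suc k) j - p k j)"
    if k: "k < m" and x: "\<tau> k \<le> x" "x \<le> \<tau> (Suc k)" for k x j
  proof -
    have b: "real k \<le> real m * x" "real m * x \<le> real k + 1"
      using x m by (simp_all add: \<tau>_def field_simps)
    have split: "{..<m} = {..<k} \<union> {k} \<union> {Suc k..<m}" using k by auto
    have "(\<Sum>i<m. max 0 (min 1 (real m * x - real i)) * (p (Suc i) j - p i j)) =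
       (\<Sum>i<k. max 0 (min 1 (real m * x - real i)) * (p (Suc i) j - p i j)) +
       max 0 (min 1 (real m * x - real k)) * (p (Suc k) j - p k j) +
       (\<Sum>i=Suc k..<m. max 0 (min 1 (real m * x - real i)) * (p (Suc i) j - p i j))"
      unfolding split by (subst sum.union_disjoint; force)+
    also have "(\<Sum>i<k. max 0 (min 1 (real m * x - real i)) * (p (Suc i) j - p i j)) = (\<Sum>i<k. p (Suc i) j - p i j)"
      using b by (intro sum.cong) (auto simp: max_def min_def)
    also have "\<dots> = p k j - p 0 j" by (rule sum_lessThan_telescope)
    also have "(\<Sum>i=Suc k..<m. max 0 (min 1 (real m * x - real i)) * (p (Suc i) j - p i j)) = 0"
      using b by (intro sum.neutral) (auto simp: max_def min_def)
    also have "max 0 (min 1 (real m * x - real k)) = real m * x - real k"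
      using b by simp
    finally show ?thesis unfolding \<rho>_def by simp
  qed
  have \<tau>01: "\<tau> 0 = 0" "\<tau> m = 1" using m by (auto simp: \<tau>_def)
  have \<tau>: "\<tau> k < \<tau> (Suc k) \<and> affine_segment \<rho> (\<tau> k) (\<tau> (Suc k))" if "k < m" for k
  proof
    show "\<tau> k < \<tau> (Suc k)" using m by (simp add: \<tau>_def divide_strict_right_mono)
    have "\<rho> x = (\<lambda>j. (p k j - real k * (p (Suc k) j - p k j)) + x * (real m * (p (Suc k) j - p k j)))"
      if "x \<in> {\<tau> k..\<tau> (Suc k)}" for x
      using \<rho>_eq[OF \<open>k < m\<close>] that by (auto simp: algebra_simps)
    then show "affine_segment \<rho> (\<tau> k) (\<tau> (Suc k))"
      unfolding affine_segment_def by (intro exI ballI)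
  qed
  have in_W: "\<rho> x \<in> W" if x: "0 \<le> x" "x \<le> 1" for x
  proof -
    \<comment> \<open>The index of a piece containing \<open>x\<close>; the minimum assigns
      \<open>x = 1\<close> to the last piece.\<close>
    define k where "k = min (m - 1) (nat \<lfloor>real m * x\<rfloor>)"
    have km: "k < m" using m by (simp add: k_def)
    have mx: "0 \<le> real m * x" "real m * x \<le> real m" using x m by (auto simp: mult_left_le)
    have lo: "real k \<le> real m * x" using mx unfolding k_def by linarith
    have hi: "real m * x \<le> real k + 1" 
      using mx m unfolding k_def min_def by (auto simp: of_nat_diff)
    have "\<rho> x = (\<lambda>j. p k j + (real m * x - real k) * (p (Suc k) j - p k j))"
      using \<rho>_eq[OF km, of x] lo hi m by (auto simp: \<tau>_def field_simps)
    then show ?thesis using seg[OF km, of "real m * x - real k"] lo hi by simp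
  qed
  have cont: "continuous_map (top_of_set {0..1}) (subtopology (Euclidean_space n) W) \<rho>"
  proof -
    have "continuous_map (top_of_set {0..1}) euclideanreal (\<lambda>x. \<rho> x j)" for j
      unfolding \<rho>_def by (auto intro!: continuous_intros)
    moreover have "\<rho> x i = 0" if "0 \<le> x" "x \<le> 1" "n \<le> i" for x i
      using in_W[OF that(1,2)] W that(3) by (auto simp: topspace_Euclidean_space)
    ultimately show ?thesis using in_W
      by (auto simp: continuous_map_in_subtopology Euclidean_space_def continuous_map_componentwise_UNIV
        topspace_Euclidean_space)
  qed
  have "pl_path n W \<rho>"
    unfolding pl_path_def pathin_def using cont \<tau>01 \<tau> by blast
  moreover have "pl_length \<rho> \<le> m"
    unfolding pl_length_def by (rule maximal_segments_le[OF \<tau>01 \<tau>])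
  moreover have "\<rho> 0 = p 0"
    using \<rho>_eq[OF m, of 0] m by (auto simp: \<tau>_def)
  moreover have "\<rho> 1 = p m"
    using \<rho>_eq[of "m - 1" 1] m by (auto simp: \<tau>_def field_simps of_nat_diff)
  ultimately show ?thesis by blast
qed

section \<open>Linear independence of hyperbolic tangents\<close>

text \<open>Locates the possible poles of \<open>tanh\<close>: since
  \<open>cosh z = cos (\<i> * z)\<close>, they come from the zeros of the cosine, which are
  real.\<close>

lemma cosh_complex_eq_0_imp:
  fixes z :: complex
  assumes "cosh z = 0"
  shows "Re z = 0" "cos (Im z) = 0"
proof -
  have z: "cos (\<i> * z) = 0" using assms by (simp add: cosh_conv_cos)
  then obtain n :: int where "\<i> * z = complex_of_real (n * pi) + of_real pi / 2"
    unfolding cos_eq_0 by blast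
  then have "Im (\<i> * z) = Im (complex_of_real (n * pi) + of_real pi / 2)" by simp
  then show "Re z = 0" by simp
  have "Re (cos (\<i> * z)) = 0" using z by simp
  moreover have "exp (Re z) + exp (- Re z) > 0" by (intro add_pos_pos) auto
  ultimately show "cos (Im z) = 0" unfolding Re_cos by simp
qed

lemma tanh_complex_of_real: "tanh (complex_of_real x) = complex_of_real (tanh x)"
  by (simp add: tanh_def sinh_field_def cosh_field_def exp_of_real flip: of_real_minus)

lemma holomorphic_on_cosh: "f holomorphic_on A \<Longrightarrow> (\<lambda>z. cosh (f z)) holomorphic_on A"
  unfolding cosh_field_def by (intro holomorphic_intros) auto

lemma holomorphic_on_sinh: "f holomorphic_on A \<Longrightarrow> (\<lambda>z. sinh (f z)) holomorphic_on A"
  unfolding sinh_field_def by (intro holomorphic_intros) auto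

lemma holomorphic_on_tanh:
  "f holomorphic_on A \<Longrightarrow> (\<And>z. z \<in> A \<Longrightarrow> cosh (f z) \<noteq> 0) \<Longrightarrow> (\<lambda>z. tanh (f z)) holomorphic_on A"
  unfolding tanh_def by (intro holomorphic_on_divide holomorphic_on_cosh holomorphic_on_sinh)

text \<open>Among the terms with nonzero coefficient, one with the largest \<open>b\<close> has a pole \<open>p\<close> on the
  boundary of a strip around the real axis in which all terms are holomorphic, and no other term
  has a pole at \<open>p\<close>. Multiplying the sum by the denominator \<open>cosh\<close> of that term gives a function
  \<open>G\<close> that vanishes in the strip by analytic continuation, hence also at \<open>p\<close>.\<close>

lemma tanh_linear_independent:
  fixes F :: "real \<times> real \<Rightarrow> real"
  assumes fin: "finite K" and pos: "\<And>k. k \<in> K \<Longrightarrow> 0 < fst k"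
    and zero: "\<And>x. D + (\<Sum>k\<in>K. F k * tanh (fst k * x + snd k)) = 0"
    and "k \<in> K"
  shows "F k = 0"
proof (rule ccontr)
  assume "F k \<noteq> 0"
  define L where "L = {k\<in>K. F k \<noteq> 0}"
  have "k \<in> L" using \<open>k \<in> K\<close> \<open>F k \<noteq> 0\<close> by (simp add: L_def)
  then have L: "finite L" "L \<noteq> {}" using fin by (simp add: L_def, blast)
  have "Max (fst ` L) \<in> fst ` L" using L by (intro Max_in) auto
  then obtain k0 where k0: "k0 \<in> L" and k0_max: "fst k0 = Max (fst ` L)" by auto
  have max: "fst k \<le> fst k0" if "k \<in> L" for k unfolding k0_max using L that by (intro Max_ge) auto
  obtain b0 c0 where bc0: "k0 = (b0, c0)" by force
  have b0: "b0 > 0" using pos[of k0] k0 bc0 by (simp add: L_def)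
  have Lpos: "0 < fst k" if "k \<in> L" for k using that pos by (simp add: L_def)
  define E where "E k z = complex_of_real (fst k) * z + of_real (snd k)" for k z
  \<comment> \<open>The term \<open>k0\<close> enters as \<open>sinh\<close>, its denominator
    already cancelled, so that \<open>G\<close> makes sense at the pole of that term.\<close>
  define G where "G z = cosh (E k0 z) * (of_real D + (\<Sum>k\<in>L-{k0}. of_real (F k) * tanh (E k z)))
      + of_real (F k0) * sinh (E k0 z)" for z
  \<comment> \<open>The distance from the real axis to the nearest poles of the term
    \<open>k0\<close>.\<close>
  define r where "r = pi / (2 * b0)"
  define S where "S = {z. Im z < r} \<inter> {z. Im z > - r}"
  have r: "r > 0" "b0 * r = pi / 2" using b0 by (auto simp: r_def)
  have S: "open S" "connected S" unfolding S_def
    by (intro open_Int open_halfspace_Im_lt open_halfspace_Im_gt)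
       (intro convex_connected convex_Int convex_halfspace_Im_lt convex_halfspace_Im_gt)
  have nz: "cosh (E k z) \<noteq> 0" if "z \<in> S" "k \<in> L" for k z
  proof
    assume "cosh (E k z) = 0"
    then have "cos (fst k * Im z) = 0" using cosh_complex_eq_0_imp(2) by (fastforce simp: E_def)
    moreover have "\<bar>fst k * Im z\<bar> < pi / 2"
    proof -
      have "\<bar>fst k * Im z\<bar> = fst k * \<bar>Im z\<bar>" using Lpos[OF that(2)] by (simp add: abs_mult)
      also have "\<dots> < fst k * r" using Lpos[OF that(2)] that(1) by (intro mult_strict_left_mono) (auto simp: S_def)
      also have "\<dots> \<le> b0 * r" using max[OF that(2)] r bc0 by (intro mult_right_mono) auto
      finally show ?thesis using r by simp
    qed
    ultimately show False using cos_gt_zero_pi[of "fst k * Im z"] by linarith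
  qed
  have hol: "G holomorphic_on S" unfolding G_def E_def
    by (intro holomorphic_intros holomorphic_on_cosh holomorphic_on_sinh holomorphic_on_tanh)
       (use nz in \<open>auto simp: E_def\<close>)
  have real0: "G (of_real x) = 0" for x
  proof -
    have "(\<Sum>k\<in>K. F k * tanh (fst k * x + snd k)) = (\<Sum>k\<in>L. F k * tanh (fst k * x + snd k))"
      using fin by (intro sum.mono_neutral_right) (auto simp: L_def)
    also have "\<dots> = F k0 * tanh (b0 * x + c0) + (\<Sum>k\<in>L-{k0}. F k * tanh (fst k * x + snd k))"
      using L k0 bc0 by (simp add: sum.remove)
    finally have *: "D + (\<Sum>k\<in>L-{k0}. F k * tanh (fst k * x + snd k)) + F k0 * tanh (b0 * x + c0) = 0"
      using zero[of x] by simp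
    have E: "E k (of_real x) = of_real (fst k * x + snd k)" for k by (simp add: E_def)
    have "cosh (E k0 (of_real x)) \<noteq> 0" using nz k0 r by (simp add: S_def)
    then have "sinh (E k0 (of_real x)) = cosh (E k0 (of_real x)) * tanh (E k0 (of_real x))"
      by (simp add: tanh_def)
    moreover have "tanh (E k0 (of_real x)) = of_real (tanh (b0 * x + c0))"
      unfolding E tanh_complex_of_real by (simp add: bc0)
    ultimately have th: "of_real (F k0) * sinh (E k0 (of_real x)) =
        cosh (E k0 (of_real x)) * of_real (F k0 * tanh (b0 * x + c0))"
      by simp
    have "G (of_real x) = cosh (E k0 (of_real x)) *
      of_real (D + (\<Sum>k\<in>L-{k0}. F k * tanh (fst k * x + snd k)) + F k0 * tanh (b0 * x + c0))"
      unfolding G_def th unfolding E tanh_complex_of_real by (simp add: algebra_simps)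
    then show ?thesis unfolding * by simp
  qed
  have G0: "G z = 0" if "z \<in> S" for z
  proof (rule analytic_continuation[OF hol S])
    show "\<real> \<subseteq> S" using r by (auto simp: S_def elim!: Reals_cases)
    show "0 \<in> S" using r by (simp add: S_def)
    show "0 islimpt (\<real> :: complex set)"
    proof (rule islimptI)
      fix T :: "complex set" assume "0 \<in> T" "open T"
      then obtain e where e: "e > 0" "ball 0 e \<subseteq> T" by (meson open_contains_ball)
      then have "of_real (e / 2) \<in> T" by (intro subsetD[OF e(2)]) simp
      then show "\<exists>y\<in>\<real>. y \<in> T \<and> y \<noteq> 0" using e(1) by (intro bexI[of _ "of_real (e / 2)"]) auto
    qed
  qed (use that real0 in \<open>auto elim!: Reals_cases\<close>)
  \<comment> \<open>A vertical line on which \<open>E k0\<close> is purely imaginary; it reaches the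
    pole from inside the strip as \<open>t\<close> increases to \<open>r\<close>.\<close>
  define p where "p t = Complex (- c0 / b0) t" for t
  have Ek0: "E k0 (p r) = \<i> * of_real (pi / 2)"
    using b0 r by (simp add: E_def p_def bc0 complex_eq_iff)
  \<comment> \<open>A pole of another term at \<open>p r\<close> would force its slope to be
    \<open>b0\<close> by the imaginary part, and then its bias to be \<open>c0\<close> by the real
    part.\<close>
  have nz': "cosh (E k (p r)) \<noteq> 0" if k: "k \<in> L - {k0}" for k
  proof
    assume *: "cosh (E k (p r)) = 0"
    have "cos (fst k * r) = 0" using cosh_complex_eq_0_imp(2)[OF *] by (simp add: E_def p_def)
    moreover have "0 < fst k * r" using k Lpos r by simp
    moreover have "fst k * r \<le> b0 * r" using k max[of k] r bc0 by (intro mult_right_mono) auto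
    ultimately have "fst k * r = pi / 2"
      using cos_gt_zero_pi[of "fst k * r"] r by linarith
    then have "fst k = b0" using r by (metis less_irrefl mult_right_cancel)
    moreover have "fst k * (- c0 / b0) + snd k = 0"
      using cosh_complex_eq_0_imp(1)[OF *] by (simp add: E_def p_def)
    ultimately have "k = k0" using b0 bc0 by (simp add: prod_eq_iff)
    then show False using k by simp
  qed
  have "isCont G (p r)"
    unfolding G_def E_def by (intro continuous_intros) (use nz' in \<open>auto simp: E_def\<close>)
  moreover have "((\<lambda>t. p t) \<longlongrightarrow> p r) (at_left r)"
    unfolding p_def by (intro tendsto_Complex tendsto_const tendsto_ident_at)
  ultimately have lim: "((\<lambda>t. G (p t)) \<longlongrightarrow> G (p r)) (at_left r)"
    by (rule isCont_tendsto_compose)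
  have ev: "eventually (\<lambda>t. G (p t) = 0) (at_left r)"
    using eventually_at_left_real[of "-r" r] r
    by (auto elim!: eventually_mono intro!: G0 simp: S_def p_def)
  have "G (p r) = 0"
    using tendsto_unique[OF _ lim tendsto_eventually[OF ev]] by simp
  \<comment> \<open>At \<open>p r\<close> only the \<open>sinh\<close> term survives, so
    \<open>G (p r) = 0\<close> reads \<open>F k0 * \<i> = 0\<close>.\<close>
  moreover have "\<i> * E k0 (p r) = of_real (- (pi / 2))" unfolding Ek0 by simp
  then have "cosh (E k0 (p r)) = 0" "sinh (E k0 (p r)) = \<i>"
    unfolding cosh_conv_cos sinh_conv_sin cos_of_real sin_of_real by simp_all
  ultimately have "F k0 = 0" unfolding G_def by simp
  then show False using k0 by (simp add: L_def)
qed

section \<open>Normal form of a net and reduction to few active units\<close>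

text \<open>As \<open>tanh\<close> is odd, \<open>(a, b, c)\<close> and \<open>(-a, -b, -c)\<close>
  give the same output; for \<open>b \<noteq> 0\<close> the key is the \<open>(b, c)\<close> of the
  version with positive slope.\<close>

definition unit_key :: "(nat \<Rightarrow> real) \<Rightarrow> nat \<Rightarrow> real \<times> real" where
  "unit_key w i = (\<bar>w (3 * i + 1)\<bar>, sgn (w (3 * i + 1)) * w (3 * i + 2))"

definition nonconst_units :: "nat \<Rightarrow> (nat \<Rightarrow> real) \<Rightarrow> nat set" where
  "nonconst_units h w = {i. i < h \<and> w (3 * i + 1) \<noteq> 0}"

lemma tanh_unit_key:
  assumes "w (3 * i + 1) \<noteq> 0"
  shows "tanh (w (3 * i + 1) * x + w (3 * i + 2)) =
    sgn (w (3 * i + 1)) * tanh (fst (unit_key w i) * x + snd (unit_key w i))"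
proof (cases "w (3 * i + 1) > 0")
  case False
  then have "fst (unit_key w i) * x + snd (unit_key w i) = - (w (3 * i + 1) * x + w (3 * i + 2))"
    using assms by (simp add: unit_key_def)
  then show ?thesis using False assms by (simp only: tanh_minus) simp
qed (simp add: unit_key_def)

lemma finite_nonconst_units: "finite (nonconst_units h w)"
  by (simp add: nonconst_units_def)

lemma card_unit_keys_le: "card (unit_key w ` nonconst_units h w) \<le> h"
proof -
  have "card (nonconst_units h w) \<le> card {..<h}"
    by (intro card_mono) (auto simp: nonconst_units_def)
  then show ?thesis using card_image_le[OF finite_nonconst_units] by (metis card_lessThan order_trans)
qed

text \<open>Units with \<open>b = 0\<close> are constants and go into \<open>D\<close>; units
  sharing a key are merged by adding their signed weights.\<close>

lemma net_normal_form:
  "\<exists>D F. \<forall>x. net h w x = D + (\<Sum>k\<in>unit_key w ` nonconst_units h w. F k * tanh (fst k * x + snd k))"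
proof -
  let ?I = "nonconst_units h w"
  let ?t = "\<lambda>x i. w (3 * i) * tanh (w (3 * i + 1) * x + w (3 * i + 2))"
  define D where "D = w (3 * h) + (\<Sum>i\<in>{..<h} - ?I. w (3 * i) * tanh (w (3 * i + 2)))"
  define F where "F k = (\<Sum>i | i \<in> ?I \<and> unit_key w i = k. sgn (w (3 * i + 1)) * w (3 * i))" for k
  have "net h w x = D + (\<Sum>k\<in>unit_key w ` ?I. F k * tanh (fst k * x + snd k))" for x
  proof -
    have "(\<Sum>i<h. ?t x i) = (\<Sum>i\<in>{..<h} - ?I. ?t x i) + (\<Sum>i\<in>?I. ?t x i)"
      by (intro sum.subset_diff) (auto simp: nonconst_units_def)
    also have "(\<Sum>i\<in>{..<h} - ?I. ?t x i) = (\<Sum>i\<in>{..<h} - ?I. w (3 * i) * tanh (w (3 * i + 2)))"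
      by (intro sum.cong) (auto simp: nonconst_units_def)
    also have "(\<Sum>i\<in>?I. ?t x i) = (\<Sum>k\<in>unit_key w ` ?I. \<Sum>i | i \<in> ?I \<and> unit_key w i = k. ?t x i)"
      by (rule sum.image_gen[OF finite_nonconst_units])
    also have "\<dots> = (\<Sum>k\<in>unit_key w ` ?I. F k * tanh (fst k * x + snd k))"
      unfolding F_def sum_distrib_right
      by (intro sum.cong refl) (auto simp: tanh_unit_key nonconst_units_def simp del: add_2_eq_Suc' One_nat_def add_Suc_right)
    finally show ?thesis by (simp add: net_def D_def)
  qed
  then show ?thesis by blast
qed

definition mk_params :: "nat \<Rightarrow> (nat \<Rightarrow> real) \<Rightarrow> (nat \<Rightarrow> real) \<Rightarrow> (nat \<Rightarrow> real) \<Rightarrow> real \<Rightarrow> nat \<Rightarrow> real" where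
  "mk_params h A B C d j =
    (if j < 3 * h then (if j mod 3 = 0 then A else if j mod 3 = 1 then B else C) (j div 3)
     else if j = 3 * h then d else 0)"

lemma mk_params_in_params: "mk_params h A B C d \<in> params h"
  by (auto simp: params_def topspace_Euclidean_space mk_params_def)

lemma mk_params_unit:
  assumes "i < h"
  shows "mk_params h A B C d (3 * i) = A i" "mk_params h A B C d (3 * i + 1) = B i"
    "mk_params h A B C d (3 * i + 2) = C i"
proof -
  have "(3 * i + 1) mod 3 = 1" "(3 * i + 1) div 3 = i" "(3 * i + 2) mod 3 = 2" "(3 * i + 2) div 3 = i"
    by presburger+
  then show "mk_params h A B C d (3 * i) = A i" "mk_params h A B C d (3 * i + 1) = B i"
    "mk_params h A B C d (3 * i + 2) = C i"
    using assms by (simp_all add: mk_params_def)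
qed

lemma net_mk_params: "net h (mk_params h A B C d) x = d + (\<Sum>i<h. A i * tanh (B i * x + C i))"
proof -
  have "mk_params h A B C d (3 * h) = d" by (simp add: mk_params_def)
  moreover have "(\<Sum>i<h. mk_params h A B C d (3 * i) *
      tanh (mk_params h A B C d (3 * i + 1) * x + mk_params h A B C d (3 * i + 2))) =
      (\<Sum>i<h. A i * tanh (B i * x + C i))"
    by (rule sum.cong[OF refl]) (simp only: mk_params_unit lessThan_iff)
  ultimately show ?thesis unfolding net_def by simp
qed

text \<open>Blank units may be moved freely; this serves the second, fourth and sixth segments of
  the path.\<close>

lemma net_mk_params_cong:
  assumes "\<And>i. i < h \<Longrightarrow> A i = 0 \<or> B i = B' i \<and> C i = C' i"
  shows "net h (mk_params h A B C d) = net h (mk_params h A B' C' d)"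
  unfolding fun_eq_iff net_mk_params using assms by (fastforce intro!: sum.cong)

text \<open>Comparing the normal forms of \<open>u\<close> and \<open>w\<close>, linear independence
  kills every coefficient of \<open>u\<close> whose key does not occur in \<open>w\<close>. At most
  \<open>r\<close> keys remain, and a single unit per key can carry the whole coefficient.\<close>

lemma reduce_to_few_units:
  assumes "net h u = net r w"
  shows "\<exists>A d P. P \<subseteq> {..<h} \<and> card P \<le> r \<and> (\<forall>i. i \<notin> P \<longrightarrow> A i = 0) \<and>
    net h (mk_params h A (\<lambda>i. u (3 * i + 1)) (\<lambda>i. u (3 * i + 2)) d) = net h u"
proof -
  let ?I = "nonconst_units h u"
  define K where "K = unit_key u ` ?I"
  define K' where "K' = unit_key w ` nonconst_units r w"
  have fin: "finite K" "finite K'" by (simp_all add: K_def K'_def finite_nonconst_units)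
  obtain D F where F: "\<And>x. net h u x = D + (\<Sum>k\<in>K. F k * tanh (fst k * x + snd k))"
    unfolding K_def using net_normal_form by blast
  obtain D' F' where F': "\<And>x. net r w x = D' + (\<Sum>k\<in>K'. F' k * tanh (fst k * x + snd k))"
    unfolding K'_def using net_normal_form by blast
  have F0: "F k = 0" if k: "k \<in> K - K'" for k
  proof -
    \<comment> \<open>Both coefficient families are extended by 0 to the union of the key sets, so
      that their difference gives a vanishing combination.\<close>
    let ?F = "\<lambda>k. (if k \<in> K then F k else 0) - (if k \<in> K' then F' k else 0)"
    have "?F k = 0"
    proof (rule tanh_linear_independent[where K = "K \<union> K'" and F = ?F and D = "D - D'"])
      fix x
      let ?e = "\<lambda>k. tanh (fst k * x + snd k) :: real"
      have "(\<Sum>k\<in>K \<union> K'. ?F k * ?e k) =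
          (\<Sum>k\<in>K \<union> K'. (if k \<in> K then F k * ?e k else 0)) - (\<Sum>k\<in>K \<union> K'. (if k \<in> K' then F' k * ?e k else 0))"
        unfolding sum_subtractf[symmetric] by (intro sum.cong) (auto simp: algebra_simps)
      also have "(\<Sum>k\<in>K \<union> K'. (if k \<in> K then F k * ?e k else 0)) = (\<Sum>k\<in>K. F k * ?e k)"
        using fin by (intro sum.mono_neutral_cong_right) auto
      also have "(\<Sum>k\<in>K \<union> K'. (if k \<in> K' then F' k * ?e k else 0)) = (\<Sum>k\<in>K'. F' k * ?e k)"
        using fin by (intro sum.mono_neutral_cong_right) auto
      finally show "D - D' + (\<Sum>k\<in>K \<union> K'. ?F k * ?e k) = 0"
        using F[of x] F'[of x] assms by simp
    qed (use fin k in \<open>auto simp: K_def K'_def unit_key_def nonconst_units_def\<close>)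
    then show ?thesis using k by simp
  qed
  define J where "J = K \<inter> K'"
  define rep where "rep = inv_into ?I (unit_key u)"
  define P where "P = rep ` J"
  \<comment> \<open>The sign undoes the reflection made by \<open>unit_key\<close> when the slope is
    negative.\<close>
  define A where "A i = (if i \<in> P then sgn (u (3 * i + 1)) * F (unit_key u i) else 0)" for i
  have rep: "rep k \<in> ?I" "unit_key u (rep k) = k" if "k \<in> J" for k
    using that unfolding rep_def J_def K_def by (auto intro: inv_into_into f_inv_into_f)
  have inj: "inj_on rep J" using rep(2) by (metis inj_onI)
  have PI: "P \<subseteq> ?I" using rep(1) by (auto simp: P_def)
  then have P: "P \<subseteq> {..<h}" by (auto simp: nonconst_units_def)
  have "card P \<le> card J" unfolding P_def using fin by (intro card_image_le) (simp add: J_def)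
  also have "\<dots> \<le> card K'" using fin by (intro card_mono) (auto simp: J_def)
  also have "\<dots> \<le> r" unfolding K'_def by (rule card_unit_keys_le)
  finally have card: "card P \<le> r" .
  have "net h (mk_params h A (\<lambda>i. u (3 * i + 1)) (\<lambda>i. u (3 * i + 2)) D) x = net h u x" for x
  proof -
    have "(\<Sum>i<h. A i * tanh (u (3 * i + 1) * x + u (3 * i + 2))) =
        (\<Sum>i\<in>P. F (unit_key u i) * tanh (fst (unit_key u i) * x + snd (unit_key u i)))"
      using P PI by (intro sum.mono_neutral_cong_right)
        (auto simp: A_def tanh_unit_key nonconst_units_def sgn_if simp del: add_2_eq_Suc' One_nat_def add_Suc_right)
    also have "\<dots> = (\<Sum>k\<in>J. F k * tanh (fst k * x + snd k))"
      unfolding P_def sum.reindex[OF inj] using rep by (intro sum.cong) auto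
    also have "\<dots> = (\<Sum>k\<in>K. F k * tanh (fst k * x + snd k))"
      using fin F0 by (intro sum.mono_neutral_left) (auto simp: J_def)
    finally show ?thesis unfolding net_mk_params F by simp
  qed
  then have "net h (mk_params h A (\<lambda>i. u (3 * i + 1)) (\<lambda>i. u (3 * i + 2)) D) = net h u" by blast
  moreover have "\<forall>i. i \<notin> P \<longrightarrow> A i = 0" by (simp add: A_def)
  ultimately show ?thesis using P card by blast
qed

section \<open>Relocating units and assembling the seven segments\<close>

text \<open>By inclusion-exclusion the complement of \<open>P \<union> Q\<close> has room for
  \<open>P \<inter> Q\<close>, and the rest of \<open>P\<close> stays put. The last conjunct ensures
  that moved units land on units outside \<open>P\<close>, which are blank when this is
  applied.\<close>

lemma relocation:
  fixes P Q :: "'a set"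
  assumes fin: "finite H" and sub: "P \<subseteq> H" "Q \<subseteq> H" and card: "card P + card Q \<le> card H"
  shows "\<exists>\<sigma>. inj_on \<sigma> P \<and> \<sigma> ` P \<subseteq> H \<and> \<sigma> ` P \<inter> Q = {} \<and> (\<forall>i\<in>P. \<sigma> i = i \<or> \<sigma> i \<notin> P)"
proof -
  have finPQ: "finite P" "finite Q" using fin sub finite_subset by auto
  have "card (P \<union> Q) + card (P \<inter> Q) \<le> card H"
    using card card_Un_Int[OF finPQ] by simp
  then have "card (P \<inter> Q) \<le> card (H - (P \<union> Q))"
    using finPQ sub by (subst card_Diff_subset) auto
  then obtain g where g: "g ` (P \<inter> Q) \<subseteq> H - (P \<union> Q)" "inj_on g (P \<inter> Q)"
    using card_le_inj[of "P \<inter> Q" "H - (P \<union> Q)"] finPQ fin by auto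
  define \<sigma> where "\<sigma> i = (if i \<in> Q then g i else i)" for i
  have "inj_on \<sigma> P"
    using g unfolding \<sigma>_def inj_on_def by (auto split: if_splits)
  moreover have "\<sigma> ` P \<subseteq> H" "\<sigma> ` P \<inter> Q = {}" "\<forall>i\<in>P. \<sigma> i = i \<or> \<sigma> i \<notin> P"
    using g sub by (auto simp: \<sigma>_def)
  ultimately show ?thesis by blast
qed

theorem theorem6p3:
  fixes h :: nat and w :: "nat \<Rightarrow> real"
  assumes "w \<in> params h"
    and "real (net_rank h w) \<le> real h / 2"
  shows "pl_diameter (3 * h + 1) (functional_class h w) \<le> 7"
proof -
  let ?W = "functional_class h w"
  let ?r = "net_rank h w"
  have "\<exists>w'\<in>params ?r. net h w = net ?r w'"
    unfolding net_rank_def by (rule LeastI[of _ h]) (use assms(1) in blast)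
  then obtain w' where w': "net h w = net ?r w'" by blast
  have "\<exists>\<rho>. pl_path (3 * h + 1) ?W \<rho> \<and> \<rho> 0 = u \<and> \<rho> 1 = v \<and> pl_length \<rho> \<le> 7"
    if u: "u \<in> ?W" and v: "v \<in> ?W" for u v
  proof -
    have nets: "net h u = net h w" "net h v = net h w"
      using u v by (auto simp: functional_class_def)
    let ?m = "mk_params h"
    define Bu Cu Bv Cv where "Bu = (\<lambda>i. u (3 * i + 1))" "Cu = (\<lambda>i. u (3 * i + 2))"
      "Bv = (\<lambda>i. v (3 * i + 1))" "Cv = (\<lambda>i. v (3 * i + 2))"
    note BC = this
    obtain A1 d1 P where P: "P \<subseteq> {..<h}" "card P \<le> ?r" "\<And>i. i \<notin> P \<Longrightarrow> A1 i = 0"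
      and u1: "net h (?m A1 Bu Cu d1) = net h w"
      using reduce_to_few_units[of h u ?r w'] nets w' unfolding BC by metis
    obtain A2 d2 Q where Q: "Q \<subseteq> {..<h}" "card Q \<le> ?r" "\<And>i. i \<notin> Q \<Longrightarrow> A2 i = 0"
      and v1: "net h (?m A2 Bv Cv d2) = net h w"
      using reduce_to_few_units[of h v ?r w'] nets w' unfolding BC by metis
    \<comment> \<open>Here the rank bound enters: both active sets fit side by side among the
      \<open>h\<close> units.\<close>
    have "card P + card Q \<le> card {..<h}" using P(2) Q(2) assms(2) by simp
    then obtain \<sigma> where \<sigma>: "inj_on \<sigma> P" "\<sigma> ` P \<subseteq> {..<h}" "\<sigma> ` P \<inter> Q = {}"
        "\<And>i. i \<in> P \<Longrightarrow> \<sigma> i = i \<or> \<sigma> i \<notin> P"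
      using relocation[of "{..<h}" P Q] P(1) Q(1) by auto
    define N where "N = \<sigma> ` P"
    \<comment> \<open>The unit whose \<open>(b, c)\<close> in \<open>u\<close> is copied to unit
      \<open>i\<close>, namely the one that \<open>\<sigma>\<close> relocates to \<open>i\<close> if
      there is one.\<close>
    define src where "src i = (if i \<in> N then inv_into P \<sigma> i else i)" for i
    have src_\<sigma>: "src (\<sigma> i) = i" if "i \<in> P" for i using that \<sigma>(1) by (simp add: src_def N_def)
    \<comment> \<open>Active units do not move in the second segment: an element of \<open>P\<close>
      hit by \<open>\<sigma>\<close> is a fixed point of \<open>\<sigma>\<close>.\<close>
    have src_P: "src i = i" if "i \<in> P" for i
    proof (cases "i \<in> N")
      case True
      then obtain j where j: "j \<in> P" "i = \<sigma> j" by (auto simp: N_def)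
      then show ?thesis using \<sigma>(4)[of j] src_\<sigma>[of j] that by auto
    qed (simp add: src_def)
    define A3 where "A3 i = (if i \<in> N then A1 (src i) else 0)" for i
    define B2 C2 where "B2 = (\<lambda>i. Bu (src i))" "C2 = (\<lambda>i. Cu (src i))"
    note BC2 = this
    define B4 C4 where "B4 = (\<lambda>i. if i \<in> N then B2 i else Bv i)" "C4 = (\<lambda>i. if i \<in> N then C2 i else Cv i)"
    note BC4 = this
    have u2: "net h (?m A1 B2 C2 d1) = net h w"
      unfolding u1[symmetric] by (rule net_mk_params_cong) (use src_P P(3) in \<open>metis BC2\<close>)
    have u3: "net h (?m A3 B2 C2 d1) = net h w"
    proof -
      have "(\<Sum>i<h. A3 i * tanh (B2 i * x + C2 i)) = (\<Sum>i<h. A1 i * tanh (Bu i * x + Cu i))" for x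
      proof -
        have "(\<Sum>i<h. A3 i * tanh (B2 i * x + C2 i)) =
            (\<Sum>i\<in>N. A1 (src i) * tanh (Bu (src i) * x + Cu (src i)))"
          using \<sigma>(2) by (intro sum.mono_neutral_cong_right) (auto simp: A3_def BC2 N_def)
        also have "\<dots> = (\<Sum>i\<in>P. A1 i * tanh (Bu i * x + Cu i))"
          unfolding N_def sum.reindex[OF \<sigma>(1)] using src_\<sigma> by (intro sum.cong) auto
        also have "\<dots> = (\<Sum>i<h. A1 i * tanh (Bu i * x + Cu i))"
          using P by (intro sum.mono_neutral_left) auto
        finally show ?thesis .
      qed
      then show ?thesis unfolding u1[symmetric] fun_eq_iff net_mk_params by simp
    qed
    have u4: "net h (?m A3 B4 C4 d1) = net h w"
      unfolding u3[symmetric] by (rule net_mk_params_cong) (auto simp: BC4 A3_def)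
    have u5: "net h (?m A2 B4 C4 d2) = net h w"
      unfolding v1[symmetric]
      by (rule net_mk_params_cong) (use \<sigma>(3) Q(3) in \<open>auto simp: BC4 N_def\<close>)
    define ps where "ps = [u, ?m A1 Bu Cu d1, ?m A1 B2 C2 d1, ?m A3 B2 C2 d1, ?m A3 B4 C4 d1,
      ?m A2 B4 C4 d2, ?m A2 Bv Cv d2, v]"
    have in_W: "?m A B C d \<in> ?W" if "net h (?m A B C d) = net h w" for A B C d
      using that mk_params_in_params by (simp add: functional_class_def)
    have "(\<lambda>j. (ps ! k) j + t * ((ps ! Suc k) j - (ps ! k) j)) \<in> ?W" if "k < 7" for k t
    proof -
      have "\<forall>i<h. (ps ! k) (3*i+1) = (ps ! Suc k) (3*i+1) \<and> (ps ! k) (3*i+2) = (ps ! Suc k) (3*i+2)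
          \<or> (ps ! k) (3*i) = 0 \<and> (ps ! Suc k) (3*i) = 0"
      proof (intro allI impI)
        fix i assume i: "i < h"
        \<comment> \<open>The cases \<open>k = 1\<close>, \<open>k = 3\<close> and
          \<open>k = 5\<close> move units and rest on \<open>s\<close>, \<open>a3\<close> and
          \<open>a2\<close> respectively; in the even cases every \<open>(b, c)\<close> is
          unchanged.\<close>
        have s: "src i = i \<or> A1 i = 0" using src_P P(3) by blast
        have a3: "i \<in> N \<or> A3 i = 0" by (simp add: A3_def)
        have a2: "i \<notin> N \<or> A2 i = 0" using \<sigma>(3) Q(3) by (auto simp: N_def)
        consider "k = 0" | "k = 1" | "k = 2" | "k = 3" | "k = 4" | "k = 5" | "k = 6"
          using \<open>k < 7\<close> by linarith
        then show "(ps ! k) (3*i+1) = (ps ! Suc k) (3*i+1) \<and> (ps ! k) (3*i+2) = (ps ! Suc k) (3*i+2)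
          \<or> (ps ! k) (3*i) = 0 \<and> (ps ! Suc k) (3*i) = 0"
          by cases (use s a3 a2 in \<open>auto simp: ps_def mk_params_unit[OF i, simplified] BC4 BC2 BC\<close>)
      qed
      note adjacent = this
      have "\<forall>x\<in>set ps. x \<in> ?W" unfolding ps_def using u v u1 u2 u3 u4 u5 v1 in_W by auto
      moreover have "length ps = 8" by (simp add: ps_def)
      ultimately have "ps ! k \<in> ?W" "ps ! Suc k \<in> ?W" using \<open>k < 7\<close> by simp_all
      then show ?thesis by (rule step_convex) (use adjacent in blast)
    qed
    then obtain \<rho> where "pl_path (3 * h + 1) ?W \<rho>" "\<rho> 0 = ps ! 0" "\<rho> 1 = ps ! 7" "pl_length \<rho> \<le> 7"
      using polygonal_path[of 7 ?W "3 * h + 1" "\<lambda>k. ps ! k"]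
      by (auto simp: functional_class_def params_def)
    then show ?thesis by (auto simp: ps_def)
  qed
  then have "pl_diameter (3 * h + 1) ?W \<le> enat 7" unfolding pl_diameter_le_iff by blast
  then show ?thesis by (simp add: numeral_eq_enat)
qed

end
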